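(* Let $u_1$ and $u_2$ be nonempty packed words of respective lengths $n$ and $m$. Then $$(\mathbf M_{u_1}\prec\mathbf M_{u_2})(\mathbb X)=\frac{1-q^n}{1-q^{n+m}}\cdot\frac{q^m-t^{N(u_2)}}{1-t^{N(u_2)}}\,\mathbf M_{u_1}(\mathbb X)\mathbf M_{u_2}(\mathbb X),$$ $$(\mathbf M_{u_1}\circ\mathbf M_{u_2})(\mathbb X)=\frac{(1-q^n)(1-q^m)}{1-q^{n+m}}\cdot\frac{1-t^{N(u_1)+N(u_2)}}{(1-t^{N(u_1)})(1-t^{N(u_2)})}\,\mathbf M_{u_1}(\mathbb X)\mathbf M_{u_2}(\mathbb X),$$ $$(\mathbf M_{u_1}\succ\mathbf M_{u_2})(\mathbb X)=\frac{1-q^m}{1-q^{n+m}}\cdot\frac{q^n-t^{N(u_1)}}{1-t^{N(u_1)}}\,\mathbf M_{u_1}(\mathbb X)\mathbf M_{u_2}(\mathbb X),$$ where $N(w)$ is the number of occurrences of the maximal letter of $w$ in $w$.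
   Context: A packed word is a word over positive integers with letter set $\{1,\dots,p\}$; $\mathrm{pack}(w)$ replaces each occurrence of the $j$-th smallest letter of $w$ by $j$. $\mathbf{WQSym}$ has basis $\mathbf M_u$ indexed by packed words. For packed words $w',w''$, the tridendriform partial products are $\mathbf M_{w'}\prec\mathbf M_{w''}=\sum\mathbf M_w$, $\mathbf M_{w'}\circ\mathbf M_{w''}=\sum\mathbf M_w$, $\mathbf M_{w'}\succ\mathbf M_{w''}=\sum\mathbf M_w$, each sum over packed words $w=uv$ with $|u|=|w'|$, $\mathrm{pack}(u)=w'$, $\mathrm{pack}(v)=w''$, subject respectively to $\max(v)<\max(u)$, $\max(v)=\max(u)$, $\max(v)>\max(u)$. The $(q,t)$-specialization at $\mathbb X=\frac1{1-q}\hat\times(1-t)$ is the linear map given, for a packed word $u$ of length $N$ with evaluation $(i_1,\dots,i_p)=(|u|_1,\dots,|u|_p)$, by $$\mathbf M_u(\mathbb X)=\frac{1-t^{i_p}}{1-q^N}\prod_{k=1}^{p-1}\frac{q^{i_1+\cdots+i_k}-t^{i_k}}{1-q^{i_1+\cdots+i_k}}.$$ *)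

theory Defs
  imports "HOL-Library.Poly_Mapping" "HOL-Computational_Algebra.Polynomial_Factorial"
begin

definition packed :: "nat list \<Rightarrow> bool" where
  "packed w \<longleftrightarrow> (\<exists>p. set w = {1..p})"

text \<open>The \<open>j\<close>-th smallest letter of \<open>w\<close> is the one with exactly \<open>j\<close> letters below or equal to it.\<close>

definition pack :: "nat list \<Rightarrow> nat list" where
  "pack w = map (\<lambda>a. card {b \<in> set w. b \<le> a}) w"

typedef packed_word = "{w :: nat list. packed w}"
  morphisms letters Packed_Word
  by (rule exI[of _ "[]"]) (auto simp: packed_def intro: exI[of _ 0])

text \<open>The maximal letter. By convention it is \<open>0\<close> for the empty word.\<close>

definition max_letter :: "nat list \<Rightarrow> nat" where
  "max_letter w = Max (insert 0 (set w))"

definition max_mult :: "nat list \<Rightarrow> nat" where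
  "max_mult w = count_list w (max_letter w)"

type_synonym 'a wqsym = "packed_word \<Rightarrow>\<^sub>0 'a"

definition M :: "packed_word \<Rightarrow> 'a::field wqsym" where
  "M u = Poly_Mapping.single u 1"

text \<open>The index set of a partial product of two basis elements; the relation \<open>R\<close> is imposed
  on \<open>max(v)\<close> and \<open>max(u)\<close>, in this order.\<close>

definition tri_words :: "(nat \<Rightarrow> nat \<Rightarrow> bool) \<Rightarrow> packed_word \<Rightarrow> packed_word \<Rightarrow> packed_word set" where
  "tri_words R w' w'' =
     {w. \<exists>u v. letters w = u @ v \<and> length u = length (letters w') \<and>
               pack u = letters w' \<and> pack v = letters w'' \<and> R (max_letter v) (max_letter u)}"

text \<open>The bilinear extension of \<open>(M w', M w'') \<mapsto> \<Sum>w\<in>tri_words R w' w''. M w\<close>.\<close>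

definition tri_prod :: "(nat \<Rightarrow> nat \<Rightarrow> bool) \<Rightarrow> 'a::field wqsym \<Rightarrow> 'a wqsym \<Rightarrow> 'a wqsym" where
  "tri_prod R f g =
     (\<Sum>w'\<in>Poly_Mapping.keys f. \<Sum>w''\<in>Poly_Mapping.keys g. \<Sum>w\<in>tri_words R w' w''.
        Poly_Mapping.single w (Poly_Mapping.lookup f w' * Poly_Mapping.lookup g w''))"

definition tri_prec :: "'a::field wqsym \<Rightarrow> 'a wqsym \<Rightarrow> 'a wqsym" (infixl "\<prec>\<^sub>W" 70) where
  "f \<prec>\<^sub>W g = tri_prod (<) f g"

definition tri_circ :: "'a::field wqsym \<Rightarrow> 'a wqsym \<Rightarrow> 'a wqsym" (infixl "\<circ>\<^sub>W" 70) where
  "f \<circ>\<^sub>W g = tri_prod (=) f g"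

definition tri_succ :: "'a::field wqsym \<Rightarrow> 'a wqsym \<Rightarrow> 'a wqsym" (infixl "\<succ>\<^sub>W" 70) where
  "f \<succ>\<^sub>W g = tri_prod (>) f g"

text \<open>The evaluation of \<open>w\<close> is \<open>(i 1, \<dots>, i p)\<close>. The formula makes no sense for the empty word,
  which gets the value \<open>1\<close> of the unit.\<close>

definition spec_word :: "'a::field \<Rightarrow> 'a \<Rightarrow> nat list \<Rightarrow> 'a" where
  "spec_word q t w =
     (if w = [] then 1
      else let p = max_letter w; i = count_list w in
        (1 - t ^ i p) / (1 - q ^ length w) *
        (\<Prod>k=1..<p. (q ^ (\<Sum>j=1..k. i j) - t ^ i k) / (1 - q ^ (\<Sum>j=1..k. i j))))"

definition specialize :: "'a::field \<Rightarrow> 'a \<Rightarrow> 'a wqsym \<Rightarrow> 'a" where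
  "specialize q t f =
     (\<Sum>u\<in>Poly_Mapping.keys f. Poly_Mapping.lookup f u * spec_word q t (letters u))"

text \<open>The index sets are finite, so the sums over them are genuine sums.\<close>

lemma finite_tri_words: "finite (tri_words R w' w'')"
proof -
  let ?n = "length (letters w') + length (letters w'')"
  have "set (letters w) \<subseteq> {..?n} \<and> length (letters w) = ?n" if w: "w \<in> tri_words R w' w''" for w
  proof -
    from w obtain u v where uv: "letters w = u @ v" "length u = length (letters w')"
      "pack v = letters w''"
      by (auto simp: tri_words_def)
    have "length v = length (letters w'')"
      using arg_cong[OF uv(3), of length] by (simp add: pack_def)
    then have len: "length (letters w) = ?n"
      using uv by simp
    have "packed (letters w)"
      using letters[of w] by simp
    then obtain p where p: "set (letters w) = {1..p}"
      by (auto simp: packed_def)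
    then have "p \<le> length (letters w)"
      using card_length[of "letters w"] by simp
    then show ?thesis
      using p len by auto
  qed
  then have "letters ` tri_words R w' w'' \<subseteq> {xs. set xs \<subseteq> {..?n} \<and> length xs = ?n}"
    by auto
  moreover have "finite {xs. set xs \<subseteq> {..?n} \<and> length xs = ?n}"
    by (rule finite_lists_length_eq) simp
  ultimately have "finite (letters ` tri_words R w' w'')"
    by (rule finite_subset)
  then show ?thesis
    by (rule finite_imageD) (simp add: inj_on_def letters_inject)
qed

text \<open>The two variables of a field of rational functions \<open>K(q, t)\<close> are not roots of unity.\<close>

lemma indeterminates_not_roots_of_unity:
  fixes k :: nat
  assumes "k > 0"
  shows "to_fract ([:0, 1:] :: 'k::field poly poly) ^ k \<noteq> 1"
    and "to_fract ([:[:0, 1:]:] :: 'k::field poly poly) ^ k \<noteq> 1"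
proof -
  have pow: "to_fract x ^ k = to_fract (x ^ k)" for x :: "'k poly poly"
    by (induction k) simp_all
  have one: "to_fract x ^ k \<noteq> 1" if "x ^ k \<noteq> 1" for x :: "'k poly poly"
    using that unfolding pow by (metis to_fract_1 to_fract_eq_iff)
  have "poly ([:0, 1:] ^ k :: 'k poly poly) 0 \<noteq> poly 1 0"
    using assms by (simp add: poly_power power_0_left)
  then show "to_fract ([:0, 1:] :: 'k poly poly) ^ k \<noteq> 1"
    by (intro one) metis
  have "poly (poly ([:[:0, 1:]:] ^ k :: 'k poly poly) 0) 0 \<noteq> poly (poly 1 0) 0"
    using assms by (simp add: poly_power power_0_left)
  then show "to_fract ([:[:0, 1:]:] :: 'k poly poly) ^ k \<noteq> 1"
    by (intro one) metis
qed

end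

theory Submission
  imports Defs
begin

text \<open>
  A word \<open>uv\<close> occurring in a product of \<open>M u1\<close> and \<open>M u2\<close> is determined by the letter sets
  \<open>S\<close> of \<open>u\<close> and \<open>T\<close> of \<open>v\<close>, which are subject only to \<open>S \<union> T\<close> being an initial interval, and its
  evaluation is the corresponding quasi-shuffle of the evaluations of \<open>u1\<close> and \<open>u2\<close>. If the
  exceptional last factor of the specialization is replaced by one of the same shape as the
  others, the resulting product is multiplicative for quasi-shuffles (induction on the
  largest letter). Splitting off the largest letter of \<open>uv\<close> reduces each of the three
  partial products to this multiplicativity.
\<close>

section \<open>Ranks in a finite set and the packing of words\<close>

text \<open>On a finite \<open>S\<close> this is the increasing bijection onto
  \<open>{1..card S}\<close>. Since it counts only elements up to \<open>a\<close>, adding larger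
  elements to \<open>S\<close> does not change it.\<close>

definition rank :: "nat set \<Rightarrow> nat \<Rightarrow> nat" where
  "rank S a = card {b \<in> S. b \<le> a}"

lemma pack_eq_map_rank: "pack w = map (rank (set w)) w"
  by (simp add: pack_def rank_def)

text \<open>The rank is strictly increasing on \<open>S\<close>, hence injective; its image lies in
  an interval with \<open>card S\<close> elements and therefore fills it.\<close>

lemma bij_betw_rank:
  assumes "finite S"
  shows "bij_betw (rank S) S {1..card S}"
proof -
  have less: "rank S a < rank S b" if "a < b" "b \<in> S" for a b
  proof -
    have "{i \<in> S. i \<le> a} \<subseteq> {i \<in> S. i \<le> b}" "b \<in> {i \<in> S. i \<le> b}" "b \<notin> {i \<in> S. i \<le> a}"
      using that by auto
    then have "{i \<in> S. i \<le> a} \<subset> {i \<in> S. i \<le> b}" by blast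
    then show ?thesis
      unfolding rank_def using assms by (intro psubset_card_mono) auto
  qed
  have inj: "inj_on (rank S) S"
  proof (rule inj_onI)
    fix a b assume "a \<in> S" "b \<in> S" "rank S a = rank S b"
    then show "a = b"
      using less[of a b] less[of b a] by (cases a b rule: linorder_cases) auto
  qed
  have "rank S a \<in> {1..card S}" if "a \<in> S" for a
  proof -
    have "card {a} \<le> rank S a"
      unfolding rank_def using that assms by (intro card_mono) auto
    moreover have "rank S a \<le> card S"
      unfolding rank_def using assms by (intro card_mono) auto
    ultimately show ?thesis by simp
  qed
  then have "rank S ` S = {1..card S}"
    using inj by (intro card_subset_eq) (auto simp: card_image)
  with inj show ?thesis by (simp add: bij_betw_def)
qed

lemma rank_atLeastAtMost: "k \<le> s \<Longrightarrow> rank {1..s} k = k"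
proof -
  assume "k \<le> s"
  then have "{b \<in> {1..s}. b \<le> k} = {1..k}" by auto
  then show ?thesis by (simp add: rank_def)
qed

lemma set_pack: "set (pack w) = {1..card (set w)}"
  using bij_betw_rank[of "set w"] by (simp add: pack_eq_map_rank bij_betw_def)

lemma count_list_map_inj_on:
  assumes "inj_on f A" "set xs \<subseteq> A" "x \<in> A"
  shows "count_list (map f xs) (f x) = count_list xs x"
  using assms(2) by (induction xs) (use assms(1,3) in \<open>auto dest: inj_onD\<close>)

lemma count_list_pack:
  "a \<in> set w \<Longrightarrow> count_list (pack w) (rank (set w) a) = count_list w a"
  using bij_betw_rank[of "set w"]
  by (auto simp: pack_eq_map_rank bij_betw_def intro!: count_list_map_inj_on)

lemma sum_count_list_subset:
  assumes "finite A" "set w \<subseteq> A"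
  shows "sum (count_list w) A = length w"
  using assms(2)
proof (induction w)
  case (Cons a w)
  have "sum (count_list (a # w)) A = (\<Sum>x\<in>A. count_list w x + (if a = x then 1 else 0))"
    by (rule sum.cong) auto
  with Cons assms(1) show ?case by (simp add: sum.distrib)
qed simp

lemma max_letter_interval: "set w = {1..p} \<Longrightarrow> max_letter w = p"
  by (cases p) (auto simp: max_letter_def intro!: Max_eqI)

section \<open>Quasi-shuffles and their recursion on the last position\<close>

text \<open>A quasi-shuffle of sequences of lengths \<open>p\<close> and \<open>r\<close> is encoded by the sets of positions
  that receive a term of the first and of the second sequence.\<close>

definition quasi_shuffles :: "nat \<Rightarrow> nat \<Rightarrow> (nat set \<times> nat set) set" where
  "quasi_shuffles p r =
     {(S, T). S \<union> T = {1..card (S \<union> T)} \<and> card S = p \<and> card T = r}"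

text \<open>For the evaluations \<open>c\<close> and \<open>d\<close> of two packed words this is
  the evaluation of the word \<open>uv\<close> whose parts have letter sets \<open>S\<close> and
  \<open>T\<close>: a shared letter collects its occurrences from both parts.\<close>

definition shuffled ::
  "(nat \<Rightarrow> nat) \<Rightarrow> (nat \<Rightarrow> nat) \<Rightarrow> nat set \<Rightarrow> nat set \<Rightarrow> nat \<Rightarrow> nat" where
  "shuffled c d S T k =
     (if k \<in> S then c (rank S k) else 0) + (if k \<in> T then d (rank T k) else 0)"

text \<open>The flag lets a single construction cover all three ways of occupying a new last
  position \<open>s\<close>.\<close>

definition extend_if :: "bool \<Rightarrow> nat \<Rightarrow> nat set \<Rightarrow> nat set" where
  "extend_if a s S = (if a then insert s S else S)"

text \<open>The flags record which sides occupy the last position. The pairs (True, False), (True,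
  True), (False, True) will match the products \<prec>, \<circ>, \<succ>.\<close>

definition shuffles_with_top :: "bool \<Rightarrow> bool \<Rightarrow> nat \<Rightarrow> nat \<Rightarrow> (nat set \<times> nat set) set" where
  "shuffles_with_top a b p r =
     {(S, T) \<in> quasi_shuffles p r. (card (S \<union> T) \<in> S \<longleftrightarrow> a) \<and> (card (S \<union> T) \<in> T \<longleftrightarrow> b)}"

lemma quasi_shufflesD:
  assumes "(S, T) \<in> quasi_shuffles p r"
  shows "S \<union> T = {1..card (S \<union> T)}" "finite S" "finite T" "card S = p" "card T = r"
    "\<And>k. k \<in> S \<Longrightarrow> 1 \<le> k \<and> k \<le> card (S \<union> T)" "\<And>k. k \<in> T \<Longrightarrow> 1 \<le> k \<and> k \<le> card (S \<union> T)"
proof -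
  show *: "S \<union> T = {1..card (S \<union> T)}" "card S = p" "card T = r"
    using assms by (auto simp: quasi_shuffles_def)
  \<comment> \<open>Finiteness has to come from the equation with an interval: \<open>card\<close>
    is 0 on infinite sets, so the cardinalities alone do not give it.\<close>
  have "finite (S \<union> T)" by (subst *(1)) simp
  then show "finite S" "finite T" by auto
  show "\<And>k. k \<in> S \<Longrightarrow> 1 \<le> k \<and> k \<le> card (S \<union> T)" "\<And>k. k \<in> T \<Longrightarrow> 1 \<le> k \<and> k \<le> card (S \<union> T)"
    using *(1) atLeastAtMost_iff by blast+
qed

lemma finite_quasi_shuffles: "finite (quasi_shuffles p r)"
proof (rule finite_subset)
  show "quasi_shuffles p r \<subseteq> Pow {1..p + r} \<times> Pow {1..p + r}"
  proof clarify
    fix S T assume ST: "(S, T) \<in> quasi_shuffles p r"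
    have "card (S \<union> T) \<le> p + r"
      using card_Un_le[of S T] quasi_shufflesD(4,5)[OF ST] by simp
    then show "S \<in> Pow {1..p + r} \<and> T \<in> Pow {1..p + r}"
      using quasi_shufflesD(6,7)[OF ST] by fastforce
  qed
qed simp

lemma quasi_shuffles_swap: "(S, T) \<in> quasi_shuffles p r \<longleftrightarrow> (T, S) \<in> quasi_shuffles r p"
  by (auto simp: quasi_shuffles_def Un_commute)

lemma quasi_shuffles_0: "quasi_shuffles p 0 = {({1..p}, {})}"
proof -
  have "S = {1..p} \<and> T = {}" if "(S, T) \<in> quasi_shuffles p 0" for S T
  proof -
    note D = quasi_shufflesD[OF that]
    have T: "T = {}" using D(3,5) by simp
    have "S = {1..p}" using D(1) unfolding T Un_empty_right D(4) .
    with T show ?thesis by simp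
  qed
  moreover have "({1..p}, {}) \<in> quasi_shuffles p 0"
    by (simp add: quasi_shuffles_def)
  ultimately show ?thesis unfolding set_eq_iff split_paired_All by blast
qed

lemma quasi_shuffles_0_left: "quasi_shuffles 0 r = {({}, {1..r})}"
  using quasi_shuffles_swap[of _ _ 0 r] by (auto simp: quasi_shuffles_0)

lemma extend_union:
  assumes "(S, T) \<in> quasi_shuffles p r" "a \<or> b"
  shows "extend_if a (Suc (card (S \<union> T))) S \<union> extend_if b (Suc (card (S \<union> T))) T
      = {1..Suc (card (S \<union> T))}"
proof -
  have "extend_if a (Suc (card (S \<union> T))) S \<union> extend_if b (Suc (card (S \<union> T))) T
      = insert (Suc (card (S \<union> T))) (S \<union> T)"
    using assms(2) by (auto simp: extend_if_def)
  also have "\<dots> = insert (Suc (card (S \<union> T))) {1..card (S \<union> T)}"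
    using quasi_shufflesD(1)[OF assms(1)] by simp
  also have "\<dots> = {1..Suc (card (S \<union> T))}" by auto
  finally show ?thesis .
qed

text \<open>Appending a last position is undone by deleting it. Only the sides that occupy it gain a
  term, which accounts for \<open>of_bool a\<close> and \<open>of_bool b\<close>.\<close>

lemma bij_betw_extend:
  assumes ab: "a \<or> b"
  shows "bij_betw (\<lambda>(S, T). (extend_if a (Suc (card (S \<union> T))) S, extend_if b (Suc (card (S \<union> T))) T))
    (quasi_shuffles p r) (shuffles_with_top a b (p + of_bool a) (r + of_bool b))"
proof (rule bij_betw_byWitness[where f' = "\<lambda>(S, T). (S - {card (S \<union> T)}, T - {card (S \<union> T)})"])
  let ?f = "\<lambda>(S, T). (extend_if a (Suc (card (S \<union> T))) S, extend_if b (Suc (card (S \<union> T))) T)"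
  let ?g = "\<lambda>(S, T). (S - {card (S \<union> T)}, T - {card (S \<union> T)})"
  have new: "Suc (card (S \<union> T)) \<notin> S" "Suc (card (S \<union> T)) \<notin> T"
    if "(S, T) \<in> quasi_shuffles p r" for S T
    using quasi_shufflesD(6,7)[OF that, of "Suc (card (S \<union> T))"] by auto
  show "\<forall>x\<in>quasi_shuffles p r. ?g (?f x) = x"
  proof
    fix x assume x: "x \<in> quasi_shuffles p r"
    obtain S T where xST: "x = (S, T)" by (cases x)
    with x have ST: "(S, T) \<in> quasi_shuffles p r" by simp
    show "?g (?f x) = x"
      using new[OF ST] by (simp add: xST extend_union[OF ST ab]) (auto simp: extend_if_def)
  qed
  show "?f ` quasi_shuffles p r \<subseteq> shuffles_with_top a b (p + of_bool a) (r + of_bool b)"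
  proof (rule image_subsetI)
    fix x assume x: "x \<in> quasi_shuffles p r"
    obtain S T where xST: "x = (S, T)" by (cases x)
    with x have ST: "(S, T) \<in> quasi_shuffles p r" by simp
    show "?f x \<in> shuffles_with_top a b (p + of_bool a) (r + of_bool b)"
      using new[OF ST] quasi_shufflesD(2-5)[OF ST]
      by (simp add: xST shuffles_with_top_def quasi_shuffles_def extend_union[OF ST ab])
        (auto simp: extend_if_def)
  qed
  have shrink: "?f (?g (S, T)) = (S, T) \<and> ?g (S, T) \<in> quasi_shuffles p r"
    if asm: "(S, T) \<in> shuffles_with_top a b (p + of_bool a) (r + of_bool b)" for S T
  proof -
    define s where "s = card (S \<union> T)"
    have ST: "(S, T) \<in> quasi_shuffles (p + of_bool a) (r + of_bool b)"
      and top: "s \<in> S \<longleftrightarrow> a" "s \<in> T \<longleftrightarrow> b"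
      using asm by (auto simp: shuffles_with_top_def s_def)
    note D = quasi_shufflesD[OF ST, folded s_def]
    \<comment> \<open>One side occupies \<open>s\<close>, so \<open>s - 1\<close> below is a true
      predecessor and not a truncated difference.\<close>
    have pos: "s \<ge> 1" using top ab D(6,7) by blast
    have "(S - {s}) \<union> (T - {s}) = {1..s} - {s}"
      unfolding D(1)[symmetric] by blast
    also have "\<dots> = {1..s - 1}" using pos by auto
    finally have un: "(S - {s}) \<union> (T - {s}) = {1..s - 1}" .
    have "card (S - {s}) = p" "card (T - {s}) = r"
      using D(2-5) top by (auto simp: card_Diff_singleton_if)
    then have "(S - {s}, T - {s}) \<in> quasi_shuffles p r"
      by (simp add: quasi_shuffles_def un)
    moreover have "extend_if a s (S - {s}) = S" "extend_if b s (T - {s}) = T"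
      using top by (auto simp: extend_if_def)
    moreover have "Suc (card ((S - {s}) \<union> (T - {s}))) = s"
      using pos by (simp add: un)
    ultimately show ?thesis
      by (simp only: prod.case s_def[symmetric])
  qed
  show "\<forall>x\<in>shuffles_with_top a b (p + of_bool a) (r + of_bool b). ?f (?g x) = x"
    using shrink by fast
  show "?g ` shuffles_with_top a b (p + of_bool a) (r + of_bool b) \<subseteq> quasi_shuffles p r"
    using shrink by fast
qed

text \<open>Every term of \<open>c\<close> and of \<open>d\<close> is placed exactly once. The total
  is therefore the same for all quasi-shuffles, and so is the denominator of the last
  factor.\<close>

lemma sum_shuffled:
  assumes "(S, T) \<in> quasi_shuffles p r"
  shows "(\<Sum>j=1..card (S \<union> T). shuffled c d S T j) = (\<Sum>i=1..p. c i) + (\<Sum>i=1..r. d i)"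
proof -
  note D = quasi_shufflesD[OF assms]
  have part: "(\<Sum>j\<in>S \<union> T. if j \<in> X then f (rank X j) else 0) = (\<Sum>i=1..card X. f i)"
    if "X = S \<or> X = T" for X and f :: "nat \<Rightarrow> nat"
  proof -
    have "(\<Sum>j\<in>S \<union> T. if j \<in> X then f (rank X j) else 0) = (\<Sum>j\<in>X. f (rank X j))"
      using that D(2,3) by (intro sum.mono_neutral_cong_right) auto
    also have "\<dots> = (\<Sum>i=1..card X. f i)"
      using that D(2,3) by (intro sum.reindex_bij_betw bij_betw_rank) auto
    finally show ?thesis .
  qed
  show ?thesis
    unfolding D(1)[symmetric] shuffled_def sum.distrib
    using part[of S c] part[of T d] D(4,5) by simp
qed

text \<open>The new position lies above all others: it alters no earlier rank, and its own rank is
  the next free one on each side that occupies it.\<close>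

lemma shuffled_extend:
  assumes ST: "(S, T) \<in> quasi_shuffles p r"
  defines "s \<equiv> Suc (card (S \<union> T))"
  shows "k \<le> card (S \<union> T) \<Longrightarrow>
      shuffled c d (extend_if a s S) (extend_if b s T) k = shuffled c d S T k"
    and "shuffled c d (extend_if a s S) (extend_if b s T) s =
      of_bool a * c (Suc p) + of_bool b * d (Suc r)"
proof -
  note D = quasi_shufflesD[OF ST]
  have old: "rank (extend_if x s X) k = rank X k" if "k \<le> card (S \<union> T)" for x X k
  proof -
    have "{i \<in> extend_if x s X. i \<le> k} = {i \<in> X. i \<le> k}"
      using that by (auto simp: extend_if_def s_def)
    then show ?thesis by (simp add: rank_def)
  qed
  then show "k \<le> card (S \<union> T) \<Longrightarrow>
      shuffled c d (extend_if a s S) (extend_if b s T) k = shuffled c d S T k"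
    by (auto simp: shuffled_def extend_if_def s_def)
  have new: "s \<notin> S" "s \<notin> T"
    using D(6,7)[of s] by (auto simp: s_def)
  have le: "i \<le> s" if "i \<in> S \<or> i \<in> T" for i
    using that D(6,7)[of i] by (auto simp: s_def)
  have "{i \<in> insert s S. i \<le> s} = insert s S" "{i \<in> insert s T. i \<le> s} = insert s T"
    using le by auto
  then have "rank (insert s S) s = Suc p" "rank (insert s T) s = Suc r"
    using D new by (simp_all add: rank_def)
  then show "shuffled c d (extend_if a s S) (extend_if b s T) s =
      of_bool a * c (Suc p) + of_bool b * d (Suc r)"
    using new by (simp add: shuffled_def extend_if_def)
qed

section \<open>Multiplicativity over quasi-shuffles\<close>

text \<open>The uniform variant of the specialization. \<open>spec_word\<close> of a nonempty word
  is this product, stopped before the maximal letter, times the exceptional factor.\<close>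

definition spec_prod :: "'a::field \<Rightarrow> 'a \<Rightarrow> (nat \<Rightarrow> nat) \<Rightarrow> nat \<Rightarrow> 'a" where
  "spec_prod q t e p =
     (\<Prod>k=1..p. (q ^ (\<Sum>j=1..k. e j) - t ^ e k) / (1 - q ^ (\<Sum>j=1..k. e j)))"

lemma spec_prod_0 [simp]: "spec_prod q t e 0 = 1"
  by (simp add: spec_prod_def)

lemma spec_prod_Suc:
  "spec_prod q t e (Suc p) = spec_prod q t e p *
     ((q ^ (\<Sum>j=1..Suc p. e j) - t ^ e (Suc p)) / (1 - q ^ (\<Sum>j=1..Suc p. e j)))"
  by (simp add: spec_prod_def)

lemma spec_prod_cong:
  assumes "\<And>k. 1 \<le> k \<Longrightarrow> k \<le> p \<Longrightarrow> e k = e' k"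
  shows "spec_prod q t e p = spec_prod q t e' p"
proof -
  have "(\<Sum>j=1..k. e j) = (\<Sum>j=1..k. e' j)" if "k \<le> p" for k
    using that assms by (intro sum.cong) auto
  then show ?thesis
    unfolding spec_prod_def using assms by (intro prod.cong) auto
qed

text \<open>Once the occupants of the last position are fixed, the total and the last term are
  constant, so any last factor \<open>h\<close> of these two numbers comes out of the sum. It serves
  twice: with the uniform factor in the induction, and with the exceptional factor for the
  specialization.\<close>

lemma sum_shuffles_with_top:
  fixes q t :: "'a::field" and c d :: "nat \<Rightarrow> nat" and h :: "nat \<Rightarrow> nat \<Rightarrow> 'a"
  assumes ab: "a \<or> b"
  shows "(\<Sum>(S, T)\<in>shuffles_with_top a b (p + of_bool a) (r + of_bool b).
      spec_prod q t (shuffled c d S T) (card (S \<union> T) - 1) *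
        h (\<Sum>j=1..card (S \<union> T). shuffled c d S T j) (shuffled c d S T (card (S \<union> T)))) =
    (\<Sum>(S, T)\<in>quasi_shuffles p r. spec_prod q t (shuffled c d S T) (card (S \<union> T))) *
      h ((\<Sum>i=1..p + of_bool a. c i) + (\<Sum>i=1..r + of_bool b. d i))
        (of_bool a * c (Suc p) + of_bool b * d (Suc r))"
    (is "sum ?G _ = sum ?F _ * ?H")
proof -
  let ?f = "\<lambda>(S, T). (extend_if a (Suc (card (S \<union> T))) S, extend_if b (Suc (card (S \<union> T))) T)"
  have "sum ?G (shuffles_with_top a b (p + of_bool a) (r + of_bool b)) =
      (\<Sum>x\<in>quasi_shuffles p r. ?G (?f x))"
    by (rule sum.reindex_bij_betw[OF bij_betw_extend[OF ab], symmetric])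
  also have "\<dots> = (\<Sum>x\<in>quasi_shuffles p r. ?F x * ?H)"
  proof (rule sum.cong[OF refl])
    fix x assume x: "x \<in> quasi_shuffles p r"
    obtain S T where xST: "x = (S, T)" by (cases x)
    with x have ST: "(S, T) \<in> quasi_shuffles p r" by simp
    let ?s = "Suc (card (S \<union> T))"
    let ?S = "extend_if a ?s S" and ?T = "extend_if b ?s T"
    have card: "card (?S \<union> ?T) = ?s"
      by (simp add: extend_union[OF ST ab])
    have "(?S, ?T) \<in> quasi_shuffles (p + of_bool a) (r + of_bool b)"
      using bij_betwE[OF bij_betw_extend[OF ab], of p r] ST
      by (auto simp: shuffles_with_top_def)
    from sum_shuffled[OF this, of c d, unfolded card]
    show "?G (?f x) = ?F x * ?H"
      using spec_prod_cong[of "card (S \<union> T)" "shuffled c d ?S ?T" "shuffled c d S T" q t]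
        shuffled_extend[OF ST]
      by (simp only: xST card prod.case diff_Suc_1)
  qed
  finally show ?thesis
    by (simp only: sum_distrib_right)
qed

text \<open>The condition \<open>p > 0\<close> excludes the empty quasi-shuffle, whose last position
  would be 0 and belong to neither side.\<close>

lemma quasi_shuffles_split:
  assumes "p > 0"
  shows "quasi_shuffles p r = shuffles_with_top True False p r \<union>
    (shuffles_with_top False True p r \<union> shuffles_with_top True True p r)"
proof -
  have "card (S \<union> T) \<in> S \<or> card (S \<union> T) \<in> T" if "(S, T) \<in> quasi_shuffles p r" for S T
  proof -
    note D = quasi_shufflesD[OF that]
    from assms D(4) obtain x where "x \<in> S" by (metis card.empty ex_in_conv less_numeral_extra(3))
    then have "card (S \<union> T) \<in> {1..card (S \<union> T)}" using D(6)[of x] by auto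
    then show ?thesis using D(1) by blast
  qed
  then show ?thesis by (auto simp: shuffles_with_top_def)
qed

text \<open>This combines the last factors in the inductive step: \<open>A\<close> and
  \<open>B\<close> are the powers of \<open>q\<close> at the two totals, \<open>x\<close> and
  \<open>y\<close> the powers of \<open>t\<close> at the two last terms, and the summands belong to
  the three possible occupants of the last position. Clearing denominators leaves the polynomial
  identity \<open>num\<close>.\<close>

lemma quasi_shuffle_identity:
  fixes A B x y :: "'a::field"
  assumes "A \<noteq> 1" "B \<noteq> 1" "A * B \<noteq> 1"
  shows "(B - y) / (1 - B) * ((A * B - x) / (1 - A * B)) +
     ((A - x) / (1 - A) * ((A * B - y) / (1 - A * B)) + (A * B - x * y) / (1 - A * B)) =
     (A - x) / (1 - A) * ((B - y) / (1 - B))"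
proof -
  define u v w where "u = 1 - A" and "v = 1 - B" and "w = 1 - A * B"
  have nz: "u \<noteq> 0" "v \<noteq> 0" "w \<noteq> 0" using assms by (auto simp: u_def v_def w_def)
  have num: "(B - y) * (A * B - x) * u + ((A - x) * (A * B - y) * v + (A * B - x * y) * (u * v)) =
      (A - x) * (B - y) * w"
    unfolding u_def v_def w_def by (simp add: algebra_simps)
  have "(B - y) / v * ((A * B - x) / w) + ((A - x) / u * ((A * B - y) / w) + (A * B - x * y) / w) =
      ((B - y) * (A * B - x) * u + ((A - x) * (A * B - y) * v + (A * B - x * y) * (u * v))) /
      (u * v * w)"
    using nz by (simp add: add_divide_distrib)
  also have "\<dots> = (A - x) / u * ((B - y) / v)"
    unfolding num using nz by simp
  finally show ?thesis unfolding u_def v_def w_def .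
qed

text \<open>Induction on \<open>p + r\<close>: removing the last position leaves quasi-shuffles of
  shorter sequences, and \<open>quasi_shuffle_identity\<close> recombines the three cases. Positive
  terms make the totals positive, which keeps the denominators nonzero.\<close>

theorem spec_prod_quasi_shuffle:
  fixes q t :: "'a::field"
  assumes q: "\<And>k. k > 0 \<Longrightarrow> q ^ k \<noteq> 1"
    and "\<And>i. 1 \<le> i \<Longrightarrow> i \<le> p \<Longrightarrow> c i > 0" and "\<And>i. 1 \<le> i \<Longrightarrow> i \<le> r \<Longrightarrow> d i > 0"
  shows "(\<Sum>(S, T)\<in>quasi_shuffles p r. spec_prod q t (shuffled c d S T) (card (S \<union> T))) =
    spec_prod q t c p * spec_prod q t d r"
  using assms(2,3)
proof (induction "p + r" arbitrary: p r rule: less_induct)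
  case less
  let ?F = "\<lambda>(S, T). spec_prod q t (shuffled c d S T) (card (S \<union> T))"
  consider "p = 0" | "r = 0" | p' r' where "p = Suc p'" "r = Suc r'"
    by (metis not0_implies_Suc)
  then show ?case
  proof cases
    case 1
    have "spec_prod q t (shuffled c d {} {1..r}) r = spec_prod q t d r"
      by (rule spec_prod_cong) (auto simp: shuffled_def rank_atLeastAtMost[simplified])
    then show ?thesis using 1 by (simp add: quasi_shuffles_0_left)
  next
    case 2
    have "spec_prod q t (shuffled c d {1..p} {}) p = spec_prod q t c p"
      by (rule spec_prod_cong) (auto simp: shuffled_def rank_atLeastAtMost[simplified])
    then show ?thesis using 2 by (simp add: quasi_shuffles_0)
  next
    case (3 p' r')
    have pos: "p > 0" using 3 by simp
    define A where "A = q ^ (\<Sum>i=1..p. c i)"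
    define B where "B = q ^ (\<Sum>i=1..r. d i)"
    define x where "x = t ^ c p"
    define y where "y = t ^ d r"
    have "(\<Sum>i=1..p. c i) > 0" "(\<Sum>i=1..r. d i) > 0"
      using less.prems(1)[of p] less.prems(2)[of r] 3 by auto
    then have neq: "A \<noteq> 1" "B \<noteq> 1" "A * B \<noteq> 1"
      unfolding A_def B_def power_add[symmetric] by (auto intro!: q)
    \<comment> \<open>Here \<open>p0\<close> and \<open>r0\<close> are the lengths after removing
      the last position; \<open>a \<or> b\<close> makes \<open>p0 + r0\<close> smaller than
      \<open>p + r\<close>, so the induction hypothesis applies.\<close>
    have step: "sum ?F (shuffles_with_top a b (p0 + of_bool a) (r0 + of_bool b)) =
       spec_prod q t c p0 * spec_prod q t d r0 *
       ((A * B - t ^ (of_bool a * c (Suc p0) + of_bool b * d (Suc r0))) / (1 - A * B))"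
      if ab: "a \<or> b" and "p0 + of_bool a = p" "r0 + of_bool b = r" for a b p0 r0
    proof -
      have IH: "sum ?F (quasi_shuffles p0 r0) = spec_prod q t c p0 * spec_prod q t d r0"
        using that less.prems by (intro less.hyps) (auto split: if_splits)
      have "sum ?F (shuffles_with_top a b (p0 + of_bool a) (r0 + of_bool b)) =
        (\<Sum>(S, T)\<in>shuffles_with_top a b (p0 + of_bool a) (r0 + of_bool b).
          spec_prod q t (shuffled c d S T) (card (S \<union> T) - 1) *
          (\<lambda>N k. (q ^ N - t ^ k) / (1 - q ^ N))
            (\<Sum>j=1..card (S \<union> T). shuffled c d S T j) (shuffled c d S T (card (S \<union> T))))"
      proof (rule sum.cong[OF refl])
        fix z assume "z \<in> shuffles_with_top a b (p0 + of_bool a) (r0 + of_bool b)"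
        moreover obtain S T where z: "z = (S, T)" by (cases z)
        ultimately have "(S, T) \<in> shuffles_with_top a b (p0 + of_bool a) (r0 + of_bool b)" by simp
        then have ST: "(S, T) \<in> quasi_shuffles (p0 + of_bool a) (r0 + of_bool b)"
          and "card (S \<union> T) \<in> S \<or> card (S \<union> T) \<in> T"
          using ab by (auto simp: shuffles_with_top_def)
        \<comment> \<open>The product must be nonempty for its last factor to be split off.\<close>
        then have "card (S \<union> T) \<ge> 1"
          using quasi_shufflesD(6,7)[OF ST] by blast
        then obtain s where "card (S \<union> T) = Suc s"
          by (cases "card (S \<union> T)") auto
        then show "?F z = (case z of (S, T) \<Rightarrow> spec_prod q t (shuffled c d S T) (card (S \<union> T) - 1) *
          (\<lambda>N k. (q ^ N - t ^ k) / (1 - q ^ N))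
            (\<Sum>j=1..card (S \<union> T). shuffled c d S T j) (shuffled c d S T (card (S \<union> T))))"
          by (simp only: z prod.case spec_prod_Suc diff_Suc_1)
      qed
      also have "\<dots> = spec_prod q t c p0 * spec_prod q t d r0 *
         ((A * B - t ^ (of_bool a * c (Suc p0) + of_bool b * d (Suc r0))) / (1 - A * B))"
        by (subst sum_shuffles_with_top[OF ab])
          (simp only: IH that(2,3) A_def B_def power_add)
      finally show ?thesis .
    qed
    define P where "P = spec_prod q t c p'"
    define Q where "Q = spec_prod q t d r'"
    have full: "spec_prod q t c p = P * ((A - x) / (1 - A))"
      "spec_prod q t d r = Q * ((B - y) / (1 - B))"
      by (simp_all only: 3 spec_prod_Suc P_def Q_def A_def B_def x_def y_def)
    \<comment> \<open>A side that does not occupy the last position keeps its own last factor, while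
      an occupying side contributes only its shortened product \<open>P\<close> or
      \<open>Q\<close>.\<close>
    have tops: "sum ?F (shuffles_with_top True False p r) =
        P * (Q * ((B - y) / (1 - B))) * ((A * B - x) / (1 - A * B))"
      "sum ?F (shuffles_with_top False True p r) =
        P * ((A - x) / (1 - A)) * Q * ((A * B - y) / (1 - A * B))"
      "sum ?F (shuffles_with_top True True p r) = P * Q * ((A * B - x * y) / (1 - A * B))"
      unfolding full[symmetric]
      using step[of True False p' r] step[of False True p r'] step[of True True p' r']
      by (simp_all add: 3[symmetric] P_def Q_def x_def y_def power_add)
    have fin: "finite (shuffles_with_top a b p r)" for a b
      by (rule finite_subset[OF _ finite_quasi_shuffles[of p r]])
        (auto simp: shuffles_with_top_def)
    have "sum ?F (quasi_shuffles p r) = sum ?F (shuffles_with_top True False p r) +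
      (sum ?F (shuffles_with_top False True p r) + sum ?F (shuffles_with_top True True p r))"
    proof -
      have "shuffles_with_top False True p r \<inter> shuffles_with_top True True p r = {}"
        "shuffles_with_top True False p r \<inter>
          (shuffles_with_top False True p r \<union> shuffles_with_top True True p r) = {}"
        by (auto simp: shuffles_with_top_def)
      then show ?thesis
        unfolding quasi_shuffles_split[OF pos]
        by (simp add: sum.union_disjoint fin)
    qed
    also have "\<dots> = P * Q * ((B - y) / (1 - B) * ((A * B - x) / (1 - A * B)) +
      ((A - x) / (1 - A) * ((A * B - y) / (1 - A * B)) + (A * B - x * y) / (1 - A * B)))"
      unfolding tops by (simp only: distrib_left mult.assoc mult.left_commute)
    also have "\<dots> = spec_prod q t c p * spec_prod q t d r"
      unfolding quasi_shuffle_identity[OF neq] full by (simp only: mult.assoc mult.left_commute)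
    finally show ?thesis .
  qed
qed

section \<open>Words of a partial product as quasi-shuffles\<close>

lemma spec_word_eq_spec_prod:
  assumes "w \<noteq> []"
  shows "spec_word q t w = spec_prod q t (count_list w) (max_letter w - 1) *
    ((1 - t ^ max_mult w) / (1 - q ^ length w))"
proof -
  have "{1..<max_letter w} = {1..max_letter w - 1}" by auto
  then show ?thesis
    using assms by (simp add: spec_word_def spec_prod_def max_mult_def Let_def)
qed

text \<open>With its packing prescribed, each part of \<open>uv\<close> is recovered from its letter
  set by inverting the rank, and \<open>uv\<close> is packed exactly when the union of the two
  letter sets is an initial interval. Hypothesis \<open>R\<close> turns the comparison of maxima
  into a condition on who owns the top letter.\<close>

lemma bij_betw_letter_sets:
  assumes w': "set (letters w') = {1..p}" and w'': "set (letters w'') = {1..r}"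
    and R: "\<And>S T. (S, T) \<in> quasi_shuffles p r \<Longrightarrow>
      R (Max (insert 0 T)) (Max (insert 0 S)) \<longleftrightarrow> (S, T) \<in> shuffles_with_top a b p r"
  shows "bij_betw (\<lambda>w. (set (take (length (letters w')) (letters w)),
      set (drop (length (letters w')) (letters w))))
    (tri_words R w' w'') (shuffles_with_top a b p r)"
    (is "bij_betw ?f _ _")
proof (rule bij_betw_imageI)
  show "inj_on ?f (tri_words R w' w'')"
  proof (rule inj_onI)
    fix x y assume "x \<in> tri_words R w' w''" "y \<in> tri_words R w' w''" and eq: "?f x = ?f y"
    then obtain u v u' v' where
      x: "letters x = u @ v" "length u = length (letters w')"
        "pack u = letters w'" "pack v = letters w''" and
      y: "letters y = u' @ v'" "length u' = length (letters w')"
        "pack u' = letters w'" "pack v' = letters w''"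
      by (auto simp: tri_words_def)
    have "set u = set u'" "set v = set v'"
      using eq x y by auto
    \<comment> \<open>Packing maps \<open>rank (set u)\<close> over \<open>u\<close>; this function
      is injective on the letters, so the letter set and the packing determine the word.\<close>
    moreover have "u = u'" if "set u = set u'" "pack u = pack u'" for u u'
      using that bij_betw_rank[of "set u"]
      by (auto simp: pack_eq_map_rank bij_betw_def dest: map_inj_on)
    ultimately have "letters x = letters y"
      using x y by metis
    then show "x = y" by (simp add: letters_inject)
  qed
  show "?f ` tri_words R w' w'' = shuffles_with_top a b p r"
  proof (rule set_eqI, rule iffI)
    fix z assume "z \<in> ?f ` tri_words R w' w''"
    then obtain w where w: "w \<in> tri_words R w' w''" and z: "z = ?f w" by blast
    then obtain u v where
      uv: "letters w = u @ v" "length u = length (letters w')"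
        "pack u = letters w'" "pack v = letters w''" "R (max_letter v) (max_letter u)"
      by (auto simp: tri_words_def)
    obtain s where s: "set (letters w) = {1..s}"
      using letters[of w] by (auto simp: packed_def)
    have "card (set u) = p" "card (set v) = r"
      using set_pack[of u] set_pack[of v] uv w' w'' by auto
    moreover have "set u \<union> set v = {1..s}" using s uv by simp
    ultimately have "(set u, set v) \<in> quasi_shuffles p r"
      by (simp add: quasi_shuffles_def)
    then show "z \<in> shuffles_with_top a b p r"
      using R uv by (simp add: z max_letter_def)
  next
    fix z assume z: "z \<in> shuffles_with_top a b p r"
    then obtain S T where zST: "z = (S, T)" by (cases z)
    have ST: "(S, T) \<in> quasi_shuffles p r"
      using z by (auto simp: zST shuffles_with_top_def)
    note D = quasi_shufflesD[OF ST]
    have unpack: "\<exists>u. pack u = x \<and> set u = X" if x: "set x = {1..card X}" and "finite X" for x X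
    proof -
      note bij = bij_betw_rank[OF \<open>finite X\<close>]
      \<comment> \<open>Letter \<open>j\<close> of \<open>x\<close> becomes the \<open>j\<close>-th
        smallest element of \<open>X\<close>.\<close>
      let ?u = "map (inv_into X (rank X)) x"
      have set: "set ?u = X"
        using bij_betw_inv_into[OF bij] x by (simp add: bij_betw_def)
      have "map (rank X) ?u = x"
        unfolding list.map_comp using bij_betw_inv_into_right[OF bij] x by (intro map_idI) simp
      then show ?thesis
        using set by (metis pack_eq_map_rank)
    qed
    obtain u v where u: "pack u = letters w'" "set u = S" and v: "pack v = letters w''" "set v = T"
      using unpack[of "letters w'" S] unpack[of "letters w''" T] D w' w'' by blast
    have "packed (u @ v)"
      using D(1) u v by (auto simp: packed_def)
    then have l: "letters (Packed_Word (u @ v)) = u @ v"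
      by (simp add: Packed_Word_inverse)
    have len: "length u = length (letters w')"
      using arg_cong[OF u(1), of length] by (simp add: pack_def)
    have "R (max_letter v) (max_letter u)"
      using R[OF ST] z zST u v by (simp add: max_letter_def)
    then have "Packed_Word (u @ v) \<in> tri_words R w' w''"
      using l len u v by (auto simp: tri_words_def)
    moreover have "z = ?f (Packed_Word (u @ v))"
      using l len u v zST by simp
    ultimately show "z \<in> ?f ` tri_words R w' w''" by blast
  qed
qed

text \<open>Packing renames each letter to its rank and keeps multiplicities; a letter missing from
  one part contributes 0 there, as in \<open>shuffled\<close>.\<close>

lemma count_list_tri_word:
  assumes "pack u = w'" "pack v = w''"
  shows "count_list (u @ v) = shuffled (count_list w') (count_list w'') (set u) (set v)"
  using count_list_pack[of _ u] count_list_pack[of _ v] assms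
  by (auto simp: fun_eq_iff shuffled_def)

text \<open>A part that reaches the top letter of \<open>uv\<close> has its own maximal letter set
  aside, so \<open>p\<close> and \<open>r\<close> count the remaining letters. The sum moves to
  letter sets, the exceptional top factor comes out, and multiplicativity evaluates the
  rest.\<close>

lemma sum_spec_word_tri_words:
  fixes q t :: "'a::field"
  assumes q: "\<And>k. k > 0 \<Longrightarrow> q ^ k \<noteq> 1"
    and ab: "a \<or> b"
    and w': "set (letters w') = {1..p + of_bool a}" and w'': "set (letters w'') = {1..r + of_bool b}"
    and ne: "letters w' \<noteq> []"
    and R: "\<And>S T. (S, T) \<in> quasi_shuffles (p + of_bool a) (r + of_bool b) \<Longrightarrow>
      R (Max (insert 0 T)) (Max (insert 0 S)) \<longleftrightarrow>
      (S, T) \<in> shuffles_with_top a b (p + of_bool a) (r + of_bool b)"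
  shows "(\<Sum>w\<in>tri_words R w' w''. spec_word q t (letters w)) =
    spec_prod q t (count_list (letters w')) p * spec_prod q t (count_list (letters w'')) r *
    ((1 - t ^ (of_bool a * count_list (letters w') (Suc p) + of_bool b * count_list (letters w'') (Suc r))) /
      (1 - q ^ (length (letters w') + length (letters w''))))"
proof -
  let ?c = "count_list (letters w')" and ?d = "count_list (letters w'')"
  let ?n = "length (letters w')" and ?m = "length (letters w'')"
  let ?f = "\<lambda>w. (set (take ?n (letters w)), set (drop ?n (letters w)))"
  let ?h = "\<lambda>N k. (1 - t ^ k) / (1 - q ^ N)"
  let ?G = "\<lambda>(S, T). spec_prod q t (shuffled ?c ?d S T) (card (S \<union> T) - 1) *
    ?h (\<Sum>j=1..card (S \<union> T). shuffled ?c ?d S T j) (shuffled ?c ?d S T (card (S \<union> T)))"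
  have "spec_word q t (letters w) = ?G (?f w)" if w: "w \<in> tri_words R w' w''" for w
  proof -
    obtain u v where
      uv: "letters w = u @ v" "length u = ?n" "pack u = letters w'" "pack v = letters w''"
      using w by (auto simp: tri_words_def)
    obtain s where s: "set (letters w) = {1..s}"
      using letters[of w] by (auto simp: packed_def)
    then have card: "card (set u \<union> set v) = s" using uv by simp
    have max: "max_letter (letters w) = s" using s by (rule max_letter_interval)
    \<comment> \<open>The length is rewritten as the total of the evaluation, the first argument
      that the last factor takes in \<open>sum_shuffles_with_top\<close>.\<close>
    have len: "length (letters w) = (\<Sum>j=1..s. count_list (letters w) j)"
      using s by (simp add: sum_count_list_subset)
    \<comment> \<open>This rules out the default value 1 of \<open>spec_word\<close>.\<close>
    have "letters w \<noteq> []" using uv ne by auto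
    from spec_word_eq_spec_prod[OF this, of q t]
    show ?thesis
      unfolding len max_mult_def max using uv card
      by (simp add: count_list_tri_word[OF uv(3,4)] del: count_list_append)
  qed
  then have "(\<Sum>w\<in>tri_words R w' w''. spec_word q t (letters w)) =
      (\<Sum>w\<in>tri_words R w' w''. ?G (?f w))"
    by (rule sum.cong[OF refl])
  also have "\<dots> = sum ?G (shuffles_with_top a b (p + of_bool a) (r + of_bool b))"
    by (rule sum.reindex_bij_betw[OF bij_betw_letter_sets[OF w' w'' R]])
  also have "\<dots> = spec_prod q t ?c p * spec_prod q t ?d r *
      ?h (?n + ?m) (of_bool a * ?c (Suc p) + of_bool b * ?d (Suc r))"
  proof -
    have "?c i > 0" if "1 \<le> i" "i \<le> p" for i
      using that w' by (auto simp: count_list_0_iff intro!: gr0I)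
    moreover have "?d i > 0" if "1 \<le> i" "i \<le> r" for i
      using that w'' by (auto simp: count_list_0_iff intro!: gr0I)
    moreover have "sum ?c {1..p + of_bool a} = ?n" "sum ?d {1..r + of_bool b} = ?m"
      by (simp_all only: sum_count_list_subset w' w'' finite_atLeastAtMost order_refl)
    ultimately show ?thesis
      by (subst sum_shuffles_with_top[OF ab, where h = ?h])
        (simp only: spec_prod_quasi_shuffle[OF q])
  qed
  finally show ?thesis .
qed

section \<open>Specialization of the three partial products\<close>

lemma specialize_M: "specialize q t (M u) = spec_word q t (letters u)"
  by (simp add: specialize_def M_def)

text \<open>The index set is finite and lists each word once, so all coefficients are 0 or 1 and the
  support of the product is the index set itself.\<close>

lemma specialize_tri_prod_M:
  "specialize q t (tri_prod R (M w') (M w'')) =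
     (\<Sum>w\<in>tri_words R w' w''. spec_word q t (letters w))"
proof -
  have prod: "tri_prod R (M w') (M w'') =
      (\<Sum>w\<in>tri_words R w' w''. Poly_Mapping.single w (1 :: 'a))"
    by (simp add: tri_prod_def M_def)
  have lookup: "Poly_Mapping.lookup (tri_prod R (M w') (M w'')) w =
      (if w \<in> tri_words R w' w'' then 1 else (0 :: 'a))" for w
    by (simp add: prod lookup_sum lookup_single when_def finite_tri_words)
  then have "Poly_Mapping.keys (tri_prod R (M w') (M w'') :: 'a wqsym) = tri_words R w' w''"
    by (auto simp: in_keys_iff split: if_splits)
  then show ?thesis
    by (simp add: specialize_def lookup)
qed

text \<open>The top position \<open>s\<close> belongs to \<open>S\<close> or \<open>T\<close>, so
  the larger maximum is \<open>s\<close>, and comparing the maxima reveals which of the two sets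
  contain it.\<close>

lemma Max_insert_0_compare:
  assumes ST: "(S, T) \<in> quasi_shuffles p r" and "p > 0"
  shows "Max (insert 0 T) < Max (insert 0 S) \<longleftrightarrow> (S, T) \<in> shuffles_with_top True False p r"
    and "Max (insert 0 T) = Max (insert 0 S) \<longleftrightarrow> (S, T) \<in> shuffles_with_top True True p r"
    and "Max (insert 0 T) > Max (insert 0 S) \<longleftrightarrow> (S, T) \<in> shuffles_with_top False True p r"
proof -
  note D = quasi_shufflesD[OF ST]
  define s where "s = card (S \<union> T)"
  have top: "s \<in> S \<or> s \<in> T"
    using ST[unfolded quasi_shuffles_split[OF assms(2)]]
    by (auto simp: shuffles_with_top_def s_def)
  \<comment> \<open>Hence the default 0 inserted for an empty set is never mistaken for the top
    position.\<close>
  have "s \<ge> 1" using top D(6,7) unfolding s_def by blast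
  have "Max (insert 0 X) = s \<longleftrightarrow> s \<in> X" "Max (insert 0 X) \<le> s" if "X = S \<or> X = T" for X
  proof -
    have fin: "finite (insert 0 X)" using that D(2,3) by auto
    have le: "\<And>k. k \<in> X \<Longrightarrow> k \<le> s" using that D(6,7) unfolding s_def by blast
    show "Max (insert 0 X) \<le> s" using fin le by simp
    show "Max (insert 0 X) = s \<longleftrightarrow> s \<in> X"
      using Max_in[OF fin] Max_ge[OF fin, of s] \<open>s \<ge> 1\<close> \<open>Max (insert 0 X) \<le> s\<close> by auto
  qed
  note max = this
  have mem: "(S, T) \<in> shuffles_with_top a b p r \<longleftrightarrow> (s \<in> S \<longleftrightarrow> a) \<and> (s \<in> T \<longleftrightarrow> b)" for a b
    using ST by (simp add: shuffles_with_top_def s_def)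
  from max[of S] max[of T] top
  show "Max (insert 0 T) < Max (insert 0 S) \<longleftrightarrow> (S, T) \<in> shuffles_with_top True False p r"
    "Max (insert 0 T) = Max (insert 0 S) \<longleftrightarrow> (S, T) \<in> shuffles_with_top True True p r"
    "Max (insert 0 T) > Max (insert 0 S) \<longleftrightarrow> (S, T) \<in> shuffles_with_top False True p r"
    unfolding mem by auto
qed

theorem theorem7p1:
  fixes q t :: "'a::field" and u1 u2 :: packed_word and n m :: nat
  assumes q: "\<And>k. k > 0 \<Longrightarrow> q ^ k \<noteq> 1"
    and t: "\<And>k. k > 0 \<Longrightarrow> t ^ k \<noteq> 1"
    and "letters u1 \<noteq> []" and "letters u2 \<noteq> []"
    and "length (letters u1) = n" and "length (letters u2) = m"
  shows "specialize q t (M u1 \<prec>\<^sub>W M u2) =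
      (1 - q ^ n) / (1 - q ^ (n + m)) * ((q ^ m - t ^ max_mult (letters u2)) / (1 - t ^ max_mult (letters u2))) *
      specialize q t (M u1) * specialize q t (M u2) \<and>
    specialize q t (M u1 \<circ>\<^sub>W M u2) =
      ((1 - q ^ n) * (1 - q ^ m)) / (1 - q ^ (n + m)) *
      ((1 - t ^ (max_mult (letters u1) + max_mult (letters u2))) / ((1 - t ^ max_mult (letters u1)) * (1 - t ^ max_mult (letters u2)))) *
      specialize q t (M u1) * specialize q t (M u2) \<and>
    specialize q t (M u1 \<succ>\<^sub>W M u2) =
      (1 - q ^ m) / (1 - q ^ (n + m)) * ((q ^ n - t ^ max_mult (letters u1)) / (1 - t ^ max_mult (letters u1))) *
      specialize q t (M u1) * specialize q t (M u2)"
proof -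
  have interval: "\<exists>p. set (letters u) = {1..Suc p}" if "letters u \<noteq> []" for u
  proof -
    obtain s where s: "set (letters u) = {1..s}"
      using letters[of u] by (auto simp: packed_def)
    then have "s \<noteq> 0" using that by (intro notI) simp
    then show ?thesis using s by (metis not0_implies_Suc)
  qed
  \<comment> \<open>The maximal letters are \<open>Suc p\<close> and \<open>Suc r\<close>, so
    \<open>P\<close> and \<open>Q\<close> below run over the letters under them.\<close>
  obtain p r where p: "set (letters u1) = {1..Suc p}" and r: "set (letters u2) = {1..Suc r}"
    using interval assms(3,4) by metis
  let ?c = "count_list (letters u1)" and ?d = "count_list (letters u2)"
  define x where "x = t ^ max_mult (letters u1)"
  define y where "y = t ^ max_mult (letters u2)"
  define A where "A = q ^ n"
  define B where "B = q ^ m"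
  define P where "P = spec_prod q t ?c p"
  define Q where "Q = spec_prod q t ?d r"
  have mult: "max_mult (letters u1) = ?c (Suc p)" "max_mult (letters u2) = ?d (Suc r)"
    by (simp_all add: max_mult_def max_letter_interval[OF p] max_letter_interval[OF r])
  have "?c (Suc p) > 0" "?d (Suc r) > 0"
    using p r by (auto simp: count_list_0_iff intro!: gr0I)
  then have nz_t: "1 - x \<noteq> 0" "1 - y \<noteq> 0"
    using t by (auto simp: x_def y_def mult)
  have "n > 0" "m > 0" using assms(3-6) by auto
  then have nz_q: "1 - A \<noteq> 0" "1 - B \<noteq> 0"
    using q by (auto simp: A_def B_def)
  have len: "(\<Sum>j=1..Suc p. ?c j) = n" "(\<Sum>j=1..Suc r. ?d j) = m"
    using sum_count_list_subset[of "{1..Suc p}" "letters u1"]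
      sum_count_list_subset[of "{1..Suc r}" "letters u2"] p r assms(5,6) by simp_all
  have full: "spec_prod q t ?c (Suc p) = P * ((A - x) / (1 - A))"
    "spec_prod q t ?d (Suc r) = Q * ((B - y) / (1 - B))"
    by (simp_all only: spec_prod_Suc len P_def Q_def A_def B_def x_def y_def mult)
  have spec: "specialize q t (M u1) = P * ((1 - x) / (1 - A))"
    "specialize q t (M u2) = Q * ((1 - y) / (1 - B))"
    using spec_word_eq_spec_prod[OF assms(3), of q t] spec_word_eq_spec_prod[OF assms(4), of q t]
    by (simp_all add: specialize_M max_letter_interval[OF p] max_letter_interval[OF r]
        assms(5,6) P_def Q_def A_def B_def x_def y_def)
  \<comment> \<open>The top letter of \<open>uv\<close> comes from \<open>u1\<close> alone:
    \<open>u2\<close> contributes its full product up to \<open>Suc r\<close>, and the exceptional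
    factor sees only the multiplicity in \<open>u1\<close>. For \<circ> the two multiplicities add
    up, and for \<succ> the roles are exchanged.\<close>
  have prec: "specialize q t (M u1 \<prec>\<^sub>W M u2) =
      P * (Q * ((B - y) / (1 - B))) * ((1 - x) / (1 - A * B))"
    unfolding tri_prec_def specialize_tri_prod_M full(2)[symmetric]
    using sum_spec_word_tri_words[OF q, of True False u1 p u2 "Suc r" "(<)" t]
      p r assms(3,5,6) Max_insert_0_compare(1)
    by (simp add: mult P_def Q_def A_def B_def x_def y_def power_add)
  have circ: "specialize q t (M u1 \<circ>\<^sub>W M u2) = P * Q * ((1 - x * y) / (1 - A * B))"
    unfolding tri_circ_def specialize_tri_prod_M
    using sum_spec_word_tri_words[OF q, of True True u1 p u2 r "(=)" t]
      p r assms(3,5,6) Max_insert_0_compare(2)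
    by (simp add: mult P_def Q_def A_def B_def x_def y_def power_add)
  have succ: "specialize q t (M u1 \<succ>\<^sub>W M u2) =
      P * ((A - x) / (1 - A)) * Q * ((1 - y) / (1 - A * B))"
    unfolding tri_succ_def specialize_tri_prod_M full(1)[symmetric]
    using sum_spec_word_tri_words[OF q, of False True u1 "Suc p" u2 r "(>)" t]
      p r assms(3,5,6) Max_insert_0_compare(3)
    by (simp add: mult P_def Q_def A_def B_def x_def y_def power_add)
  \<comment> \<open>\<open>P\<close> and \<open>Q\<close> are common to both sides of each equation.
    What remains is cancellation of \<open>1 - A\<close>, \<open>1 - B\<close>, \<open>1 - x\<close>
    and \<open>1 - y\<close>, which are nonzero.\<close>
  show ?thesis
    unfolding prec circ succ spec power_add A_def[symmetric] B_def[symmetric]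
      x_def[symmetric] y_def[symmetric]
    using nz_t nz_q by (auto simp: divide_simps)
qed

end
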